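(* Let $q$ be a prime power, $k\ge 1$, $\theta=\theta(q,k)=\frac{q^k-1}{q-1}$, and let $G_k$ be a $k\times\theta$ matrix over $\mathbb{F}_q$ whose columns form a maximal set of pairwise nonproportional nonzero vectors of $\mathbb{F}_q^k$. Let $M_k=G_k^{\mathrm T}\cdot G_k$ (product over $\mathbb{F}_q$) and let $\mathcal{N}(M_k)$ be the integer matrix obtained from $M_k$ by replacing every nonzero entry by $1$ (and keeping zero entries as $0$). Let $C$ be a linear $[n,k]_q$ code, $G$ a generator matrix of $C$, and $\chi=\chi(C,G)$ the characteristic vector of $C$ with respect to $G$. Then for every $i=1,\ldots,\theta$, the Hamming weight of the $i$-th row of the matrix $G_k^{\mathrm T}\cdot G$ (multiplication over $\mathbb{F}_q$) is equal to the $i$-th coordinate of the column vector $\mathcal{N}(M_k)\cdot\chi^{\mathrm T}$ (multiplication over $\mathbb{Z}$).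
   Context: A linear $[n,k]_q$ code is a $k$-dimensional subspace $C$ of $\mathbb{F}_q^n$; a generator matrix of $C$ is a $k\times n$ matrix over $\mathbb{F}_q$ whose rows form a basis of $C$. Standing assumption: generator matrices $G$ have no zero columns. The Hamming weight of a vector is the number of its nonzero coordinates. The characteristic vector of $C$ with respect to $G$ (and $G_k$) is $\chi(C,G)=(\chi_1,\ldots,\chi_{\theta(q,k)})\in\mathbb{Z}^{\theta(q,k)}$, where $\chi_u$ is the number of columns of $G$ that are equal or proportional (by a nonzero scalar of $\mathbb{F}_q$) to the $u$-th column of $G_k$. *)

theory Defs
  imports "Jordan_Normal_Form.VS_Connect" "HOL-Library.Cardinality"
begin

definition theta :: "nat \<Rightarrow> nat \<Rightarrow> nat" where
  "theta q k = (q ^ k - 1) div (q - 1)"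

text \<open>A linear code is a subspace of \<open>module_vec TYPE('a) n\<close>, the space of vectors of length
  \<open>n\<close> over the finite field \<open>'a\<close>; its dimension and its bases are those of the vector space
  obtained by restricting the carrier to the code.\<close>

definition linear_code :: "nat \<Rightarrow> nat \<Rightarrow> 'a::{field,finite} vec set \<Rightarrow> bool" where
  "linear_code n k C \<longleftrightarrow>
     VectorSpace.subspace class_ring C (module_vec TYPE('a) n) \<and>
     vectorspace.dim class_ring (module_vec TYPE('a) n\<lparr>carrier := C\<rparr>) = k"

text \<open>\<open>distinct\<close> is needed because \<open>set (rows G)\<close> forgets repeated rows.\<close>

definition generator_matrix ::
    "nat \<Rightarrow> nat \<Rightarrow> 'a::{field,finite} vec set \<Rightarrow> 'a mat \<Rightarrow> bool" where
  "generator_matrix n k C G \<longleftrightarrow>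
     G \<in> carrier_mat k n \<and> distinct (rows G) \<and>
     vectorspace.basis class_ring (module_vec TYPE('a) n\<lparr>carrier := C\<rparr>) (set (rows G))"

definition no_zero_columns :: "'a::zero mat \<Rightarrow> bool" where
  "no_zero_columns G \<longleftrightarrow> (\<forall>v \<in> set (cols G). v \<noteq> 0\<^sub>v (dim_row G))"

definition hamming_weight :: "'a::zero vec \<Rightarrow> nat" where
  "hamming_weight v = card {i. i < dim_vec v \<and> v $ i \<noteq> 0}"

text \<open>Equality is the case \<open>c = 1\<close>.\<close>

definition proportional :: "'a::field vec \<Rightarrow> 'a vec \<Rightarrow> bool" where
  "proportional u v \<longleftrightarrow> (\<exists>c. c \<noteq> 0 \<and> u = c \<cdot>\<^sub>v v)"

definition nonproportional_set :: "nat \<Rightarrow> 'a::field vec set \<Rightarrow> bool" where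
  "nonproportional_set k S \<longleftrightarrow>
     S \<subseteq> carrier_vec k - {0\<^sub>v k} \<and> pairwise (\<lambda>u v. \<not> proportional u v) S"

text \<open>The possible choices of the reference matrix \<open>P\<close>. Maximality is with respect to inclusion.\<close>

definition projective_matrix :: "nat \<Rightarrow> 'a::{field,finite} mat \<Rightarrow> bool" where
  "projective_matrix k P \<longleftrightarrow>
     P \<in> carrier_mat k (theta CARD('a) k) \<and> distinct (cols P) \<and>
     VectorSpace.maximal (set (cols P)) (nonproportional_set k)"

text \<open>The characteristic vector of the code generated by \<open>G\<close>, with respect to \<open>G\<close> and the
  reference matrix \<open>P\<close>; it depends on the code only through \<open>G\<close>.\<close>

definition characteristic_vector :: "'a::field mat \<Rightarrow> 'a mat \<Rightarrow> int vec" where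
  "characteristic_vector P G =
     vec (dim_col P) (\<lambda>u. int (card {j. j < dim_col G \<and> proportional (col G j) (col P u)}))"

definition nonzero_pattern :: "'a::zero mat \<Rightarrow> int mat" where
  "nonzero_pattern A = map_mat (\<lambda>x. if x = 0 then 0 else 1) A"

end

theory Submission
  imports Defs
begin

text \<open>Entry \<open>j\<close> of the \<open>i\<close>-th row of the product is the scalar
  product of column \<open>i\<close> of \<open>G\<^sub>k\<close> with column \<open>j\<close> of
  \<open>G\<close>, and whether it vanishes depends only on the proportionality class of the latter
  column. Every column of \<open>G\<close> is nonzero, so it lies in the class of exactly one column
  of \<open>G\<^sub>k\<close>: maximality gives existence (\<open>projective_matrix_col_ex\<close>),
  nonproportionality gives uniqueness (\<open>projective_matrix_col_inj\<close>). Counting the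
  nonzero entries class by class, the class of column \<open>u\<close> contributes all of its
  \<chi>_u members or none, as the 0/1 pattern dictates.\<close>

lemma proportional_refl: "proportional v v"
  unfolding proportional_def by (rule exI[of _ 1]) simp

lemma proportional_sym:
  assumes "proportional u v"
  shows "proportional v u"
proof -
  obtain c where "c \<noteq> 0" "u = c \<cdot>\<^sub>v v"
    using assms unfolding proportional_def by blast
  then have "inverse c \<noteq> 0" "v = inverse c \<cdot>\<^sub>v u"
    by (simp_all add: smult_smult_assoc)
  then show ?thesis
    unfolding proportional_def by blast
qed

lemma proportional_trans:
  assumes "proportional u v" "proportional v w"
  shows "proportional u w"
proof -
  obtain c d where "c \<noteq> 0" "u = c \<cdot>\<^sub>v v" "d \<noteq> 0" "v = d \<cdot>\<^sub>v w"
    using assms unfolding proportional_def by blast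
  then have "c * d \<noteq> 0" "u = (c * d) \<cdot>\<^sub>v w"
    by (simp_all add: smult_smult_assoc)
  then show ?thesis
    unfolding proportional_def by blast
qed

text \<open>The scalar factors out of the product and, being nonzero in a field, cannot affect
  vanishing.\<close>

lemma proportional_scalar_prod_eq_0_iff:
  assumes "proportional u v" "w \<in> carrier_vec k" "v \<in> carrier_vec k"
  shows "w \<bullet> u = 0 \<longleftrightarrow> w \<bullet> v = 0"
  using assms unfolding proportional_def by auto

text \<open>A nonzero vector proportional to no member could be adjoined to \<open>S\<close>,
  against maximality.\<close>

lemma maximal_nonproportional_set_represents:
  assumes max: "VectorSpace.maximal S (nonproportional_set k)"
    and v: "v \<in> carrier_vec k" "v \<noteq> 0\<^sub>v k"
  shows "\<exists>s\<in>S. proportional v s"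
proof (rule ccontr)
  assume neg: "\<not> ?thesis"
  have S: "nonproportional_set k S"
    using max by (simp add: VectorSpace.maximal_def)
  have "nonproportional_set k (insert v S)"
    using S v neg proportional_sym
    unfolding nonproportional_set_def pairwise_insert by blast
  then have "insert v S = S"
    using max unfolding VectorSpace.maximal_def by blast
  then show False
    using neg proportional_refl by blast
qed

lemma projective_matrix_col_inj:
  assumes P: "projective_matrix k P" and u: "u < dim_col P" and v: "v < dim_col P"
    and "proportional w (col P u)" "proportional w (col P v)"
  shows "u = v"
proof -
  have "proportional (col P u) (col P v)"
    using assms proportional_sym proportional_trans by blast
  moreover have "pairwise (\<lambda>u v. \<not> proportional u v) (set (cols P))"
    using P by (simp add: projective_matrix_def VectorSpace.maximal_def nonproportional_set_def)
  moreover have "col P u \<in> set (cols P)" "col P v \<in> set (cols P)"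
    using u v by (auto simp: cols_def)
  \<comment> \<open>Nonproportionality in a set of vectors yields only equal columns; equal indices
    then follow from \<open>distinct (cols P)\<close>.\<close>
  ultimately have "cols P ! u = cols P ! v"
    using u v unfolding pairwise_def by auto
  then show ?thesis
    using P u v nth_eq_iff_index_eq[of "cols P" u v] by (simp add: projective_matrix_def)
qed

lemma projective_matrix_col_ex:
  assumes "projective_matrix k P" "w \<in> carrier_vec k" "w \<noteq> 0\<^sub>v k"
  shows "\<exists>u<dim_col P. proportional w (col P u)"
  using assms maximal_nonproportional_set_represents[of "set (cols P)" k w]
  by (fastforce simp: projective_matrix_def cols_def)

theorem lemma1:
  fixes q k n i :: nat
    and C :: "'a::{field,finite} vec set"
    and G\<^sub>k G :: "'a mat"
  assumes "q = CARD('a)"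
    and "k \<ge> 1"
    and "projective_matrix k G\<^sub>k"
    and "linear_code n k C"
    and "generator_matrix n k C G"
    and "no_zero_columns G"
    and "i < theta q k"
  shows "int (hamming_weight (row (G\<^sub>k\<^sup>T * G) i)) =
    (nonzero_pattern (G\<^sub>k\<^sup>T * G\<^sub>k) *\<^sub>v characteristic_vector G\<^sub>k G) $ i"
proof -
  let ?t = "theta q k"
  \<comment> \<open>\<open>J u\<close> is the class counted by \<chi>_u, and \<open>U\<close> is the
    support of row \<open>i\<close> of the 0/1 pattern.\<close>
  define J where "J u = {j. j < n \<and> proportional (col G j) (col G\<^sub>k u)}" for u
  define U where "U = {u. u < ?t \<and> col G\<^sub>k i \<bullet> col G\<^sub>k u \<noteq> 0}"
  have Gk: "G\<^sub>k \<in> carrier_mat k ?t"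
    using assms(1,3) by (simp add: projective_matrix_def)
  have G: "G \<in> carrier_mat k n"
    using assms(5) by (simp add: generator_matrix_def)
  have rep: "\<exists>u<?t. proportional (col G j) (col G\<^sub>k u)" if "j < n" for j
  proof -
    have "col G j \<in> set (cols G)"
      using that G by (auto simp: cols_def)
    then have "col G j \<noteq> 0\<^sub>v k"
      using assms(6) G by (auto simp: no_zero_columns_def)
    moreover have "col G j \<in> carrier_vec k"
      using G by auto
    ultimately show ?thesis
      using projective_matrix_col_ex[OF assms(3)] Gk by auto
  qed
  have prod_iff: "col G\<^sub>k i \<bullet> col G j = 0 \<longleftrightarrow> col G\<^sub>k i \<bullet> col G\<^sub>k u = 0"
    if "proportional (col G j) (col G\<^sub>k u)" for j u
    using proportional_scalar_prod_eq_0_iff[OF that] Gk by (metis col_dim carrier_matD(1))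
  have "hamming_weight (row (G\<^sub>k\<^sup>T * G) i) = card {j. j < n \<and> col G\<^sub>k i \<bullet> col G j \<noteq> 0}"
    unfolding hamming_weight_def
    using Gk G assms(7) by (intro arg_cong[of _ _ card]) auto
  \<comment> \<open>\<open>rep\<close> puts each \<open>j\<close> into some \<open>J u\<close>, and
    \<open>prod_iff\<close> shows that each \<open>J u\<close> lies entirely inside or entirely
    outside the set.\<close>
  also have "{j. j < n \<and> col G\<^sub>k i \<bullet> col G j \<noteq> 0} = (\<Union>u\<in>U. J u)"
    unfolding U_def J_def using rep prod_iff by blast
  also have "card \<dots> = (\<Sum>u\<in>U. card (J u))"
  proof (rule card_UN_disjoint)
    show "\<forall>u\<in>U. \<forall>v\<in>U. u \<noteq> v \<longrightarrow> J u \<inter> J v = {}"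
      using projective_matrix_col_inj[OF assms(3)] Gk by (auto simp: U_def J_def)
  qed (auto simp: U_def J_def)
  finally have "int (hamming_weight (row (G\<^sub>k\<^sup>T * G) i)) = (\<Sum>u\<in>U. int (card (J u)))"
    by simp
  \<comment> \<open>Indices outside \<open>U\<close> enter with coefficient 0, which turns the sum
    into a matrix-vector product.\<close>
  also have "\<dots> = (\<Sum>u<?t. (if col G\<^sub>k i \<bullet> col G\<^sub>k u = 0 then 0 else 1) * int (card (J u)))"
    by (rule sum.mono_neutral_cong_left) (auto simp: U_def)
  also have "\<dots> = (nonzero_pattern (G\<^sub>k\<^sup>T * G\<^sub>k) *\<^sub>v characteristic_vector G\<^sub>k G) $ i"
    using Gk G assms(7)
    by (simp add: nonzero_pattern_def characteristic_vector_def scalar_prod_def J_def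
        atLeast0LessThan)
  finally show ?thesis .
qed

end
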